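(* Let $n\ge 1$, let $A_1,\dots,A_d\in\mathfrak{gl}(n)$ ($d\ge1$), and let $E_{i_1j_1},\dots,E_{i_ej_e}$ be elements of the standard basis $\{E_{ij}:1\le i,j\le n\}$ of $\mathfrak{gl}(n)$. Let $\mathcal G_{\rm drift}$ be the directed graph on $\mathrm V=\{1,\dots,n\}$ with an arc $(i,j)$ iff $[A_s]_{ij}\neq0$ for some $s$ (arcs $(i,i)$ are self-loops), and let $\mathcal G_{\rm contr}$ be the directed graph on $\mathrm V$ with arc set $\{(i_1,j_1),\dots,(i_e,j_e)\}$. Suppose that (i) each weakly connected component of $\mathcal G_{\rm contr}$ is strongly connected with at least two nodes; (ii) the union digraph $\mathcal G_{\rm drift}\cup\mathcal G_{\rm contr}$ is strongly connected; (iii) $\mathcal G_{\rm contr}$ has at least one self-loop. Then the system $\dot X=\mathsf B_0X+(\sum_{i=1}^m u_i\mathsf B_i)X$ is structurally accessible on $\mathrm{GL}^+(n)$ with respect to the pair of zero patterns $\big(\Sigma_{\rm r}(\{A_1,\dots,A_d\}),\Sigma_{\rm f}(\{E_{i_1j_1},\dots,E_{i_ej_e}\})\big)$.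
   Context: $E_{ij}$ is the $n\times n$ matrix with $(i,j)$ entry $1$ and others $0$; $\mathrm{GL}^+(n)$ is the identity component of the group of real invertible $n\times n$ matrices, with Lie algebra $\mathfrak{gl}(n)$ of all real $n\times n$ matrices. For a finite subset $\{g_1,\dots,g_k\}$ of a real Lie algebra, $\Sigma_{\rm f}(\{g_s\})=\{\sum l_sg_s:l_s\in\mathbb R\}$ and $\Sigma_{\rm r}(\{g_s\})=\{\sum l_sg_s: l_s\in\mathbb R, l_s\neq0\ \forall s\}$. For the system $\dot X=\mathsf B_0X+(\sum_{i=1}^m u_i\mathsf B_i)X$ on a connected matrix Lie group $\mathbf G$ (with $\mathsf B_i$ in its Lie algebra, controls piecewise continuous and real), $\mathcal R(I)$ is the set of states reachable at some time $T\ge0$ from $X(0)=I$; the system is accessible if $\mathcal R(I)$ has an interior point in $\mathbf G$. Structural accessibility w.r.t. $(\Sigma_{\rm r}(\mathfrak g_\alpha),\Sigma_{\rm f}(\mathfrak g_\beta))$ means: there exist $m\ge1$, $\mathsf B_0\in\Sigma_{\rm r}(\mathfrak g_\alpha)$, $\mathsf B_1,\dots,\mathsf B_m\in\Sigma_{\rm f}(\mathfrak g_\beta)$ making the system accessible. A weakly connected component of a digraph is a connected component when arc directions are ignored; a digraph is strongly connected if every two nodes are mutually reachable by directed paths. *)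

theory Defs
  imports "HOL-Analysis.Analysis"
begin

type_synonym 'n mat = "real ^ 'n ^ 'n"

text \<open>Standard basis matrix E_ij.\<close>
definition Emat :: "'n::finite \<Rightarrow> 'n \<Rightarrow> 'n mat" where
  "Emat i j = (\<chi> a b. if a = i \<and> b = j then 1 else 0)"

text \<open>GL+(n): identity component of GL(n), i.e. matrices with positive determinant.\<close>
definition GLplus :: "('n::finite) mat set" where
  "GLplus = {X. det X > 0}"

text \<open>Zero patterns: free and restricted linear spans of a finite set of matrices.\<close>
definition sigma_f :: "('n::finite) mat set \<Rightarrow> 'n mat set" where
  "sigma_f G = {(\<Sum>g\<in>G. l g *\<^sub>R g) | l. True}"

definition sigma_r :: "('n::finite) mat set \<Rightarrow> 'n mat set" where
  "sigma_r G = {(\<Sum>g\<in>G. l g *\<^sub>R g) | l. \<forall>g\<in>G. l g \<noteq> 0}"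

text \<open>Piecewise continuous real functions on [a,b]: finitely many discontinuities,
  with finite one-sided limits there.\<close>
definition piecewise_continuous_on :: "real \<Rightarrow> real \<Rightarrow> (real \<Rightarrow> real) \<Rightarrow> bool" where
  "piecewise_continuous_on a b f \<longleftrightarrow>
     (\<exists>S. finite S \<and> S \<subseteq> {a..b} \<and> continuous_on ({a..b} - S) f \<and>
       (\<forall>s\<in>S. (a < s \<longrightarrow> (\<exists>l. (f \<longlongrightarrow> l) (at_left s))) \<and>
               (s < b \<longrightarrow> (\<exists>l. (f \<longlongrightarrow> l) (at_right s)))))"

text \<open>Reachable set from the identity of the bilinear system
  X' = B0 X + (sum_{k=1..m} u_k B_k) X on GL+(n).\<close>
definition reachable_set :: "('n::finite) mat \<Rightarrow> nat \<Rightarrow> (nat \<Rightarrow> 'n mat) \<Rightarrow> 'n mat set" where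
  "reachable_set B0 m B = {Y. \<exists>T u X S. T \<ge> 0 \<and>
      (\<forall>k\<in>{1..m}. piecewise_continuous_on 0 T (u k)) \<and>
      finite S \<and> continuous_on {0..T} X \<and> X 0 = mat 1 \<and>
      (\<forall>t\<in>{0..T}. X t \<in> GLplus) \<and>
      (\<forall>t\<in>{0..T} - S. (X has_vector_derivative
           ((B0 + (\<Sum>k=1..m. u k t *\<^sub>R B k)) ** X t)) (at t within {0..T})) \<and>
      X T = Y}"

text \<open>Accessibility: the reachable set has an interior point in GL+(n)
  (GL+(n) is open in the matrix space, so this is ordinary interior).\<close>
definition accessible :: "('n::finite) mat \<Rightarrow> nat \<Rightarrow> (nat \<Rightarrow> 'n mat) \<Rightarrow> bool" where
  "accessible B0 m B \<longleftrightarrow> interior (reachable_set B0 m B \<inter> GLplus) \<noteq> {}"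

definition structurally_accessible :: "('n::finite) mat set \<Rightarrow> 'n mat set \<Rightarrow> bool" where
  "structurally_accessible Ga Gb \<longleftrightarrow>
     (\<exists>m B0 B. m \<ge> 1 \<and> B0 \<in> sigma_r Ga \<and> (\<forall>k\<in>{1..m}. B k \<in> sigma_f Gb) \<and>
        accessible B0 m B)"

text \<open>Digraphs on the node type 'n given by arc relations.\<close>
definition weak_component :: "('n \<times> 'n) set \<Rightarrow> 'n \<Rightarrow> 'n set" where
  "weak_component P i = {j. (i, j) \<in> (P \<union> P\<inverse>)\<^sup>*}"

definition strongly_connected_on :: "('n \<times> 'n) set \<Rightarrow> 'n set \<Rightarrow> bool" where
  "strongly_connected_on P C \<longleftrightarrow> (\<forall>i\<in>C. \<forall>j\<in>C. (i, j) \<in> P\<^sup>*)"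

definition drift_graph :: "nat \<Rightarrow> (nat \<Rightarrow> ('n::finite) mat) \<Rightarrow> ('n \<times> 'n) set" where
  "drift_graph d A = {(i, j). \<exists>s\<in>{1..d}. A s $ i $ j \<noteq> 0}"

end

theory Submission
  imports Defs
begin

text \<open>
  The reachable set \<open>R\<close> contains \<open>I\<close> and is stable under left multiplication by \<open>exp (tM)\<close> for
  \<open>t \<ge> 0\<close> and \<open>M\<close> in the affine space \<open>\<M>\<close> of admissible right-hand sides. Among all families of points
  of \<open>R\<close> that depend differentiably on a parameter near \<open>0\<close>, take one whose derivative at \<open>0\<close> has
  maximal rank. Flowing along \<open>M\<close> for a parameter-dependent time would increase the rank unless \<open>M\<close> is
  already tangent to the family, and this persists after further flows. Hence, for the tangent space
  \<open>W\<close>, translated to the identity, the matrices \<open>Z\<close> with \<open>h\<^sup>-\<^sup>1 Z h \<in> W\<close> for all \<open>h\<close> with \<open>h R \<subseteq> R\<close>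
  form a subspace that contains \<open>\<M>\<close> and is invariant under \<open>ad M\<close>, \<open>M \<in> \<M>\<close>. If \<open>\<M>\<close> generates
  \<open>gl(n)\<close> as a Lie algebra, the derivative is therefore onto and \<open>R\<close> has an interior point.

  For the Lie algebra, choose the drift \<open>B\<^sub>0\<close> generically, so that no entry cancels. Brackets of
  control matrices give \<open>E\<^sub>i\<^sub>j\<close> for \<open>i \<noteq> j\<close> in the same component of the control graph. At a self-loop
  \<open>k\<close>, the operator \<open>ad E\<^sub>k\<^sub>k\<close> separates row \<open>k\<close> from the rest, so \<open>E\<^sub>k\<^sub>j\<close> propagates along the arcs
  of the union digraph to all \<open>j\<close>. By transposition all \<open>E\<^sub>j\<^sub>k\<close> are obtained, and these generate
  \<open>gl(n)\<close>.
\<close>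

section \<open>Matrix exponential\<close>

lemma bounded_bilinear_matrix_mult:
  "bounded_bilinear ((**) :: real^'n^'m \<Rightarrow> real^'p^'n \<Rightarrow> real^'p^'m)"
  unfolding bilinear_conv_bounded_bilinear[symmetric] bilinear_def
  by (auto intro!: linearI
      simp: vec_eq_iff matrix_matrix_mult_def sum.distrib sum_distrib_left algebra_simps)

interpretation matrix_mult:
  bounded_bilinear "(**) :: real^'n^'m \<Rightarrow> real^'p^'n \<Rightarrow> real^'p^'m"
  by (rule bounded_bilinear_matrix_mult)

lemma has_vector_derivative_componentwise_matrix:
  fixes f :: "real \<Rightarrow> real^'n^'m"
  assumes "\<And>i j. ((\<lambda>t. f t $ i $ j) has_field_derivative D $ i $ j) (at t)"
  shows "(f has_vector_derivative D) (at t)"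
proof -
  have "((\<lambda>t. f t \<bullet> b) has_vector_derivative D \<bullet> b) (at t)" if "b \<in> Basis" for b
    using that assms
    by (auto simp: Basis_vec_def inner_axis has_real_derivative_iff_has_vector_derivative)
  then show ?thesis
    unfolding has_vector_derivative_def has_derivative_componentwise_within[of f]
    by simp
qed

definition matrix_power :: "real^'n^'n \<Rightarrow> nat \<Rightarrow> real^'n^'n" where
  "matrix_power M k = (((**) M) ^^ k) (mat 1)"

lemma matrix_power_0 [simp]: "matrix_power M 0 = mat 1"
  and matrix_power_Suc: "matrix_power M (Suc k) = M ** matrix_power M k"
  by (simp_all add: matrix_power_def)

lemma matrix_power_Suc_right: "matrix_power M (Suc k) = matrix_power M k ** M"
  by (induction k) (simp_all add: matrix_power_Suc matrix_mul_assoc)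

text \<open>Each factor \<open>M\<close> costs at most the sum of all absolute entries, since this
  dominates every absolute row sum. The geometric bound gives the entries of the exponential an
  exponential majorant.\<close>

lemma abs_matrix_power_le:
  "\<bar>matrix_power M k $ i $ j\<bar> \<le> (\<Sum>a\<in>UNIV. \<Sum>b\<in>UNIV. \<bar>M $ a $ b\<bar>) ^ k"
proof (induction k arbitrary: i j)
  case 0
  show ?case by (simp add: mat_def)
next
  case (Suc k)
  let ?c = "\<Sum>a\<in>UNIV. \<Sum>b\<in>UNIV. \<bar>M $ a $ b\<bar>"
  have c: "0 \<le> ?c" by (intro sum_nonneg) auto
  have "\<bar>matrix_power M (Suc k) $ i $ j\<bar> \<le> (\<Sum>l\<in>UNIV. \<bar>M $ i $ l * matrix_power M k $ l $ j\<bar>)"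
    by (simp add: matrix_power_Suc matrix_matrix_mult_def sum_abs)
  also have "\<dots> \<le> (\<Sum>l\<in>UNIV. \<bar>M $ i $ l\<bar> * ?c ^ k)"
    using Suc by (auto intro!: sum_mono mult_left_mono simp: abs_mult)
  also have "\<dots> = (\<Sum>l\<in>UNIV. \<bar>M $ i $ l\<bar>) * ?c ^ k"
    by (simp add: sum_distrib_right)
  also have "\<dots> \<le> ?c * ?c ^ k"
    by (intro mult_right_mono member_le_sum[where f = "\<lambda>a. \<Sum>b\<in>UNIV. \<bar>M $ a $ b\<bar>"])
      (use c in \<open>auto intro: sum_nonneg\<close>)
  finally show ?case by simp
qed

text \<open>Every entry is a scalar power series in \<open>t\<close>, so convergence and termwise
  differentiation reduce to the real case.\<close>

definition matrix_exp :: "real \<Rightarrow> real^'n^'n \<Rightarrow> real^'n^'n" where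
  "matrix_exp t M = (\<chi> i j. \<Sum>k. matrix_power M k $ i $ j / fact k * t ^ k)"

lemma summable_matrix_exp: "summable (\<lambda>k. matrix_power M k $ i $ j / fact k * t ^ k)"
proof (rule summable_comparison_test')
  let ?c = "\<Sum>a\<in>UNIV. \<Sum>b\<in>UNIV. \<bar>M $ a $ b\<bar>"
  show "summable (\<lambda>k. inverse (fact k) * (?c * \<bar>t\<bar>) ^ k)"
    by (rule summable_exp)
  show "norm (matrix_power M k $ i $ j / fact k * t ^ k) \<le> inverse (fact k) * (?c * \<bar>t\<bar>) ^ k"
    if "k \<ge> 0" for k
    using abs_matrix_power_le[of M k i j]
    by (auto simp: abs_mult power_mult_distrib power_abs divide_simps intro!: mult_right_mono)
qed

lemma matrix_exp_sums:
  "(\<lambda>k. matrix_power M k $ i $ j / fact k * t ^ k) sums (matrix_exp t M $ i $ j)"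
  using summable_matrix_exp[of M i j t] by (simp add: matrix_exp_def summable_sums)

text \<open>Both products have the same series because a power of \<open>M\<close> can be extended
  by a factor on either side. This yields commutation with \<open>M\<close> as well as the
  derivative.\<close>

lemma mult_matrix_exp_sums:
  "(\<lambda>k. matrix_power M (Suc k) $ i $ j / fact k * t ^ k) sums ((M ** matrix_exp t M) $ i $ j)"
  "(\<lambda>k. matrix_power M (Suc k) $ i $ j / fact k * t ^ k) sums ((matrix_exp t M ** M) $ i $ j)"
proof -
  have "(\<lambda>k. \<Sum>l\<in>UNIV. M $ i $ l * (matrix_power M k $ l $ j / fact k * t ^ k))
      sums (\<Sum>l\<in>UNIV. M $ i $ l * matrix_exp t M $ l $ j)"
    by (intro sums_sum sums_mult matrix_exp_sums)
  then show "(\<lambda>k. matrix_power M (Suc k) $ i $ j / fact k * t ^ k) sums ((M ** matrix_exp t M) $ i $ j)"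
    by (simp add: matrix_power_Suc matrix_matrix_mult_def sum_distrib_left
        sum_divide_distrib mult_ac)
  have "(\<lambda>k. \<Sum>l\<in>UNIV. (matrix_power M k $ i $ l / fact k * t ^ k) * M $ l $ j)
      sums (\<Sum>l\<in>UNIV. matrix_exp t M $ i $ l * M $ l $ j)"
    by (intro sums_sum sums_mult2 matrix_exp_sums)
  then show "(\<lambda>k. matrix_power M (Suc k) $ i $ j / fact k * t ^ k) sums ((matrix_exp t M ** M) $ i $ j)"
    by (simp add: matrix_power_Suc_right matrix_matrix_mult_def sum_distrib_left
        sum_divide_distrib mult_ac)
qed

lemma matrix_exp_commute: "M ** matrix_exp t M = matrix_exp t M ** M"
  unfolding vec_eq_iff
  by (intro allI sums_unique2[OF mult_matrix_exp_sums(1) mult_matrix_exp_sums(2)])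

lemma matrix_exp_0 [simp]: "matrix_exp 0 M = mat 1"
  by (simp only: matrix_exp_def vec_eq_iff vec_lambda_beta powser_zero) simp

lemma matrix_exp_has_vector_derivative:
  "((\<lambda>t. matrix_exp t M) has_vector_derivative M ** matrix_exp t M) (at t)"
proof (rule has_vector_derivative_componentwise_matrix)
  fix i j
  let ?c = "\<lambda>k. matrix_power M k $ i $ j / fact k"
  \<comment> \<open>The index shift in \<open>diffs\<close> brings down a factor k + 1, which turns
    (k + 1)! into k!.\<close>
  have "diffs ?c k = matrix_power M (Suc k) $ i $ j / fact k" for k
    by (simp add: diffs_def field_simps del: of_nat_Suc)
  then have "(\<Sum>k. diffs ?c k * t ^ k) = (M ** matrix_exp t M) $ i $ j"
    using mult_matrix_exp_sums(1)[of M i j t] by (simp add: sums_iff)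
  then show "((\<lambda>t. matrix_exp t M $ i $ j) has_field_derivative (M ** matrix_exp t M) $ i $ j) (at t)"
    using termdiffs_strong_converges_everywhere[of ?c t] summable_matrix_exp[of M i j]
    by (simp add: matrix_exp_def)
qed

lemma isCont_matrix_exp: "isCont (\<lambda>t. matrix_exp t M) t"
  using matrix_exp_has_vector_derivative has_vector_derivative_continuous by blast

lemma matrix_exp_uminus_has_vector_derivative:
  "((\<lambda>t. matrix_exp (- t) M) has_vector_derivative - (M ** matrix_exp (- t) M)) (at t)"
proof -
  have "((\<lambda>t. matrix_exp t M) \<circ> uminus has_vector_derivative - 1 *\<^sub>R (M ** matrix_exp (- t) M)) (at t)"
    by (rule vector_diff_chain_at)
      (auto intro!: derivative_eq_intros matrix_exp_has_vector_derivative)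
  then show ?thesis by (simp add: o_def)
qed

text \<open>The product has derivative 0, as \<open>M\<close> commutes with its exponential, so it
  keeps its value at time 0.\<close>

lemma matrix_exp_uminus_mult: "matrix_exp (- t) M ** matrix_exp t M = mat 1"
proof -
  let ?f = "\<lambda>t. matrix_exp (- t) M ** matrix_exp t M"
  have "(?f has_vector_derivative 0) (at t within UNIV)" for t
    using matrix_mult.has_vector_derivative[OF matrix_exp_uminus_has_vector_derivative[of M t]
        matrix_exp_has_vector_derivative[of M t]]
    by (simp add: matrix_mult.minus_left matrix_mul_assoc matrix_exp_commute[of M "- t"])
  then obtain c where "\<And>t. ?f t = c"
    using has_vector_derivative_zero_constant[of UNIV ?f] by auto
  from this[of t] this[of 0] show ?thesis by simp
qed

lemma matrix_exp_mult_uminus: "matrix_exp t M ** matrix_exp (- t) M = mat 1"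
  using matrix_exp_uminus_mult[of "- t" M] by simp

text \<open>The determinant is 1 at time 0 and never vanishes, by invertibility; connectedness of
  the real line excludes a change of sign.\<close>

lemma det_matrix_exp_pos: "det (matrix_exp t M) > 0"
proof (rule ccontr)
  assume neg: "\<not> det (matrix_exp t M) > 0"
  have nz: "det (matrix_exp s M) \<noteq> 0" for s
    using det_mul[of "matrix_exp s M" "matrix_exp (- s) M"] by (auto simp: matrix_exp_mult_uminus)
  have comp: "continuous_on UNIV (\<lambda>s. matrix_exp s M $ i $ j)" for i j
    by (intro continuous_intros continuous_at_imp_continuous_on ballI isCont_matrix_exp)
  have cont: "continuous_on UNIV (\<lambda>s. det (matrix_exp s M))"
    unfolding det_def by (intro continuous_intros comp)
  have "connected ((\<lambda>s. det (matrix_exp s M)) ` UNIV)"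
    using cont by (rule connected_continuous_image) simp
  moreover have "det (matrix_exp t M) \<in> (\<lambda>s. det (matrix_exp s M)) ` UNIV"
    "1 \<in> (\<lambda>s. det (matrix_exp s M)) ` UNIV"
    by (auto intro: image_eqI[of _ _ 0])
  ultimately have "0 \<in> (\<lambda>s. det (matrix_exp s M)) ` UNIV"
    using neg by (auto intro: connectedD_interval[of _ "det (matrix_exp t M)" 1 0])
  then show False using nz by auto
qed

section \<open>Lie algebras generated by elementary matrices\<close>

lemma Emat_nth [simp]: "Emat i j $ a $ b = (if a = i \<and> b = j then 1 else 0)"
  by (simp add: Emat_def)

lemma Emat_mult_nth: "(Emat i j ** X) $ a $ b = (if a = i then X $ j $ b else 0)"
proof -
  have "(if a = i \<and> c = j then 1 else 0) * X $ c $ b =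
      (if c = j then if a = i then X $ j $ b else 0 else 0)" for c
    by simp
  then show ?thesis by (simp add: matrix_matrix_mult_def)
qed

lemma mult_Emat_nth: "(X ** Emat i j) $ a $ b = (if b = j then X $ a $ i else 0)"
proof -
  have "X $ a $ c * (if c = i \<and> b = j then 1 else 0) =
      (if c = i then if b = j then X $ a $ i else 0 else 0)" for c
    by simp
  then show ?thesis by (simp add: matrix_matrix_mult_def)
qed

lemma transpose_Emat: "transpose (Emat i j) = Emat j i"
  by (auto simp: transpose_def vec_eq_iff)

lemma matrix_eq_sum_Emat: "X = (\<Sum>i\<in>UNIV. \<Sum>j\<in>UNIV. X $ i $ j *\<^sub>R Emat i j)"
proof -
  have "X $ i $ j * (if a = i \<and> b = j then 1 else 0) =
      (if j = b then if i = a then X $ a $ b else 0 else 0)" for a b i j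
    by simp
  then have "(\<Sum>i\<in>UNIV. \<Sum>j\<in>UNIV. X $ i $ j *\<^sub>R Emat i j) $ a $ b = X $ a $ b" for a b
    by simp
  then show ?thesis by (simp add: vec_eq_iff)
qed

lemma Emat_mult: "Emat i j ** Emat k l = (if j = k then Emat i l else 0)"
  by (auto simp: vec_eq_iff Emat_mult_nth)

definition commutator :: "real^'n^'n \<Rightarrow> real^'n^'n \<Rightarrow> real^'n^'n" where
  "commutator X Y = X ** Y - Y ** X"

lemma commutator_Emat:
  "commutator (Emat i j) (Emat k l) =
     (if j = k then Emat i l else 0) - (if l = i then Emat k j else 0)"
  by (simp add: commutator_def Emat_mult)

lemma transpose_commutator:
  "transpose (commutator X Y) = commutator (transpose Y) (transpose X)"
  unfolding commutator_def matrix_transpose_mul[symmetric]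
  by (simp add: transpose_def vec_eq_iff)

locale matrix_lie_algebra =
  fixes N :: "(real^'n::finite^'n) set"
  assumes subspace: "subspace N"
    and commutator_closed: "X \<in> N \<Longrightarrow> Y \<in> N \<Longrightarrow> commutator X Y \<in> N"
begin

lemma Emat_trans:
  assumes "Emat i j \<in> N" "Emat j l \<in> N" "i \<noteq> l"
  shows "Emat i l \<in> N"
  using commutator_closed[OF assms(1,2)] assms(3) by (auto simp: commutator_Emat)

lemma Emat_rtrancl:
  assumes "(i, j) \<in> P\<^sup>*" "\<And>a b. (a, b) \<in> P \<Longrightarrow> Emat a b \<in> N" "i \<noteq> j"
  shows "Emat i j \<in> N"
  using assms(1,3)
proof (induction rule: rtrancl_induct)
  case (step y z)
  then show ?case
    using Emat_trans[of i y z] assms(2) by (cases "i = y") auto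
qed simp

text \<open>Induction along a path from \<open>k\<close>. Arcs of \<open>P\<close> and targets that
  \<open>P\<close> reaches from \<open>k\<close> follow by transitivity. For any other arc from
  \<open>i\<close> to \<open>j\<close>, given by an entry of \<open>B\<close>, a second node
  \<open>b\<close> of the component of \<open>j\<close> serves as a detour: \<open>Emat k b\<close>
  is extracted from brackets with \<open>B\<close>, and \<open>Emat b j\<close> leads back.\<close>

lemma Emat_row:
  assumes P: "\<And>a b. (a, b) \<in> P \<Longrightarrow> Emat a b \<in> N"
    and B: "B \<in> N"
    and sym: "\<And>a b. (a, b) \<in> P\<^sup>* \<Longrightarrow> (b, a) \<in> P\<^sup>*"
    and two: "\<And>a. \<exists>b. b \<noteq> a \<and> (a, b) \<in> P\<^sup>*"
    and loop: "(k, k) \<in> P"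
    and conn: "(k, j) \<in> ({(a, b). B $ a $ b \<noteq> 0} \<union> P)\<^sup>*"
  shows "Emat k j \<in> N"
  using conn
proof (induction rule: rtrancl_induct)
  case base
  show ?case using P loop by blast
next
  case (step i j)
  show ?case
  proof (cases "i = j \<or> j = k \<or> (k, j) \<in> P\<^sup>* \<or> (i, j) \<in> P")
    case True
    then show ?thesis
      using step.IH Emat_rtrancl[of k j P] Emat_trans[of k i j] P loop by metis
  next
    case False
    then have ne: "i \<noteq> j" "j \<noteq> k" and Bij: "B $ i $ j \<noteq> 0" and kj: "(k, j) \<notin> P\<^sup>*"
      using step.hyps by auto
    obtain b where b: "b \<noteq> j" "(j, b) \<in> P\<^sup>*" using two by blast
    have bk: "b \<noteq> k" using b(2) sym kj by blast
    have jb: "Emat j b \<in> N" "Emat b j \<in> N"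
      using Emat_rtrancl[of _ _ P] P b sym by auto
    \<comment> \<open>\<open>Y\<close> equals \<open>B\<^sub>i\<^sub>j E\<^sub>k\<^sub>b + B\<^sub>b\<^sub>k E\<^sub>j\<^sub>i\<close>; bracketing with \<open>E\<^sub>k\<^sub>k\<close> isolates the first summand.\<close>
    let ?Y = "commutator (commutator (Emat k i) B) (Emat j b)"
    let ?Z = "commutator (Emat k k) ?Y"
    have kk: "Emat k k \<in> N" using P loop by blast
    have Y: "?Y \<in> N"
      using step.IH B jb commutator_closed by blast
    have "?Y = B $ i $ j *\<^sub>R Emat k b + B $ b $ k *\<^sub>R Emat j i"
      using ne bk b(1)
      by (auto simp: vec_eq_iff commutator_def mult_Emat_nth Emat_mult_nth)
    \<comment> \<open>Under bracketing with \<open>Emat k k\<close>, \<open>Emat k b\<close> has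
      eigenvalue 1, while \<open>Emat j i\<close> has eigenvalue -1 if \<open>i = k\<close> and 0
      otherwise. The operator plus its square doubles the former and kills the latter.\<close>
    then have "?Z + commutator (Emat k k) ?Z = (2 * B $ i $ j) *\<^sub>R Emat k b"
      using ne bk
      by (auto simp: vec_eq_iff commutator_def mult_Emat_nth Emat_mult_nth)
    moreover have "?Z + commutator (Emat k k) ?Z \<in> N"
      using Y kk commutator_closed subspace subspace_add by blast
    ultimately have "(1 / (2 * B $ i $ j)) *\<^sub>R (2 * B $ i $ j) *\<^sub>R Emat k b \<in> N"
      using subspace subspace_scale by metis
    then have "Emat k b \<in> N" using Bij by simp
    then show ?thesis using Emat_trans[OF _ jb(2)] ne by auto
  qed
qed

text \<open>Transposition reverses brackets and arcs, so the result on row \<open>k\<close> can be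
  applied to column \<open>k\<close>.\<close>

lemma matrix_lie_algebra_transpose: "matrix_lie_algebra (transpose ` N)"
proof
  have "linear (transpose :: real^'n^'n \<Rightarrow> real^'n^'n)"
    by (intro linearI) (simp_all add: transpose_def vec_eq_iff)
  then show "subspace (transpose ` N)"
    using subspace linear_subspace_image by blast
  show "commutator X Y \<in> transpose ` N"
    if "X \<in> transpose ` N" "Y \<in> transpose ` N" for X Y
    using that commutator_closed
    by (auto simp: transpose_commutator[symmetric])
qed

lemma eq_UNIV:
  assumes P: "\<And>a b. (a, b) \<in> P \<Longrightarrow> Emat a b \<in> N"
    and B: "B \<in> N"
    and sym: "\<And>a b. (a, b) \<in> P\<^sup>* \<Longrightarrow> (b, a) \<in> P\<^sup>*"
    and two: "\<And>a. \<exists>b. b \<noteq> a \<and> (a, b) \<in> P\<^sup>*"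
    and loop: "(k, k) \<in> P"
    and conn: "\<And>a b. (a, b) \<in> ({(a, b). B $ a $ b \<noteq> 0} \<union> P)\<^sup>*"
  shows "N = UNIV"
proof -
  let ?D = "{(a, b). B $ a $ b \<noteq> 0}"
  interpret T: matrix_lie_algebra "transpose ` N"
    by (rule matrix_lie_algebra_transpose)
  have kk: "Emat k k \<in> N" using P loop .
  have row: "Emat k j \<in> N" for j
    using Emat_row[OF P B sym two loop conn] .
  have col: "Emat j k \<in> N" for j
  proof -
    have conv: "{(a, b). transpose B $ a $ b \<noteq> 0} \<union> P\<inverse> = (?D \<union> P)\<inverse>"
      by (auto simp: transpose_def)
    have "Emat k j \<in> transpose ` N"
    proof (rule T.Emat_row)
      show "Emat a b \<in> transpose ` N" if "(a, b) \<in> P\<inverse>" for a b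
        using that P by (auto intro: image_eqI[of _ _ "Emat b a"] simp: transpose_Emat)
      show "transpose B \<in> transpose ` N" using B by blast
      show "(k, k) \<in> P\<inverse>" using loop by simp
      show "(k, j) \<in> ({(a, b). transpose B $ a $ b \<noteq> 0} \<union> P\<inverse>)\<^sup>*"
        unfolding conv using conn by (simp add: rtrancl_converse del: converse_Un)
      show "\<exists>b. b \<noteq> a \<and> (a, b) \<in> (P\<inverse>)\<^sup>*" for a
        using sym two[of a] by (auto simp: rtrancl_converse)
    qed (use sym in \<open>auto simp: rtrancl_converse\<close>)
    then show ?thesis
      by (metis (no_types, lifting) imageE transpose_Emat transpose_transpose)
  qed
  \<comment> \<open>Off the diagonal, bracket \<open>Emat i k\<close> with \<open>Emat k j\<close>.
    On the diagonal this bracket is \<open>Emat i i - Emat k k\<close>, and the self-loop supplies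
    \<open>Emat k k\<close>.\<close>
  have E: "Emat i j \<in> N" for i j
  proof (cases "i = j")
    case True
    show ?thesis
    proof (cases "i = k")
      case False
      then have "commutator (Emat i k) (Emat k i) + Emat k k = Emat i i"
        by (simp add: commutator_Emat)
      then show ?thesis
        using True commutator_closed[OF col row] kk subspace subspace_add by metis
    qed (use True kk in auto)
  qed (use Emat_trans[OF col row] in auto)
  have "X \<in> N" for X
    by (subst matrix_eq_sum_Emat) (intro subspace_sum subspace subspace_scale E)
  then show ?thesis by blast
qed

end

section \<open>From invariant subspaces to Lie algebras, and generic linear combinations\<close>

lemma jacobi_commutator:
  "commutator (commutator X Y) Z = commutator X (commutator Y Z) - commutator Y (commutator X Z)"
  by (simp add: commutator_def matrix_mult.diff_left matrix_mult.diff_right matrix_mul_assoc)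

lemma linear_commutator_left: "linear (\<lambda>X. commutator X Y)"
  by (intro linearI) (simp_all add: commutator_def matrix_mult.add_left matrix_mult.add_right
      matrix_mult.scaleR_left matrix_mult.scaleR_right scaleR_diff_right)

text \<open>Closure under brackets is the Jacobi identity. A subspace that is only known to contain
  some generators and to be invariant under brackets with them thus has a Lie subalgebra containing
  the same generators.\<close>

lemma matrix_lie_algebra_stabilizer:
  fixes U :: "(real^'n^'n) set"
  assumes "subspace U"
  shows "matrix_lie_algebra {X \<in> U. \<forall>Z\<in>U. commutator X Z \<in> U}"
proof
  show "subspace {X \<in> U. \<forall>Z\<in>U. commutator X Z \<in> U}"
    using assms
    by (auto simp: subspace_def linear_0[OF linear_commutator_left]
        linear_add[OF linear_commutator_left] linear_scale[OF linear_commutator_left])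
  show "commutator X Y \<in> {X \<in> U. \<forall>Z\<in>U. commutator X Z \<in> U}"
    if "X \<in> {X \<in> U. \<forall>Z\<in>U. commutator X Z \<in> U}"
      "Y \<in> {X \<in> U. \<forall>Z\<in>U. commutator X Z \<in> U}" for X Y
    using that assms by (auto simp: jacobi_commutator intro!: subspace_diff)
qed

text \<open>Matrices are added one at a time; each new coefficient avoids 0 and the finitely many
  values that cancel some entry.\<close>

lemma generic_combination:
  fixes G :: "(real^'n^'m) set"
  assumes "finite G"
  shows "\<exists>l. (\<forall>g\<in>G. l g \<noteq> 0) \<and>
    (\<forall>i j. (\<exists>g\<in>G. g $ i $ j \<noteq> 0) \<longrightarrow> (\<Sum>g\<in>G. l g *\<^sub>R g) $ i $ j \<noteq> 0)"
  using assms
proof (induction G rule: finite_induct)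
  case (insert h G)
  then obtain l where l: "\<forall>g\<in>G. l g \<noteq> 0"
    "\<And>i j. \<exists>g\<in>G. g $ i $ j \<noteq> 0 \<Longrightarrow> (\<Sum>g\<in>G. l g *\<^sub>R g) $ i $ j \<noteq> 0"
    by blast
  define S where "S = (\<Sum>g\<in>G. l g *\<^sub>R g)"
  \<comment> \<open>Where \<open>h $ i $ j = 0\<close>, the quotient is 0 by convention, a value
    excluded anyway.\<close>
  have "finite (insert 0 ((\<lambda>(i, j). - S $ i $ j / h $ i $ j) ` UNIV))" by simp
  then obtain x where x: "x \<noteq> 0" "\<And>i j. x \<noteq> - S $ i $ j / h $ i $ j"
    using ex_new_if_finite[OF infinite_UNIV_char_0[where 'a = real]]
    by (metis (no_types, lifting) UNIV_I case_prod_conv image_eqI insertCI)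
  let ?l = "l(h := x)"
  have "(\<Sum>g\<in>G. ?l g *\<^sub>R g) = S"
    unfolding S_def using insert.hyps by (intro sum.cong) auto
  then have sum: "(\<Sum>g\<in>insert h G. ?l g *\<^sub>R g) = x *\<^sub>R h + S"
    using insert.hyps by simp
  have "(x *\<^sub>R h + S) $ i $ j \<noteq> 0" if g: "\<exists>g\<in>insert h G. g $ i $ j \<noteq> 0" for i j
  proof (cases "h $ i $ j = 0")
    case True
    then show ?thesis using g l(2) by (auto simp: S_def)
  next
    case False
    then show ?thesis using x(2)[of i j] by (auto simp: field_simps)
  qed
  then show ?case
    using l(1) x(1) insert.hyps by (intro exI[of _ ?l]) (unfold sum, auto)
qed simp

section \<open>The Lie algebra rank condition\<close>

text \<open>Differentiability at the single point 0 and continuity nearby are what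
  \<open>sussmann_open_mapping\<close> asks for.\<close>

definition param_family ::
  "'a::real_normed_vector set \<Rightarrow> ('b::real_normed_vector \<Rightarrow> 'a) \<Rightarrow> ('b \<Rightarrow> 'a) \<Rightarrow> bool" where
  "param_family R \<Phi> D \<longleftrightarrow> (\<Phi> has_derivative D) (at 0) \<and>
     (\<exists>S. open S \<and> 0 \<in> S \<and> continuous_on S \<Phi> \<and> \<Phi> ` S \<subseteq> R)"

lemma interior_nonempty_if_param_family_surj:
  fixes \<Phi> :: "'b::euclidean_space \<Rightarrow> 'a::euclidean_space"
  assumes "param_family R \<Phi> D" "surj D"
  shows "interior R \<noteq> {}"
proof -
  from assms(1) obtain S where D: "(\<Phi> has_derivative D) (at 0)"
    and S: "open S" "0 \<in> S" "continuous_on S \<Phi>" "\<Phi> ` S \<subseteq> R"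
    unfolding param_family_def by blast
  obtain g where g: "linear g" "D \<circ> g = id"
    using linear_surjective_right_inverse[OF has_derivative_linear[OF D] assms(2)] by blast
  have "\<Phi> 0 \<in> interior (\<Phi> ` S)"
    using S g linear_conv_bounded_linear interior_open[of S]
    by (intro sussmann_open_mapping[OF S(1,3,2) D, of g]) auto
  then show ?thesis using interior_mono[OF S(4)] by blast
qed

text \<open>Flow times must be nonnegative, so the time is varied around a strictly positive
  \<open>t\<close>. The new summand of the derivative comes from varying the time; \<open>M\<close>
  commutes with its exponential, which can therefore be factored out on the left.\<close>

lemma param_family_matrix_exp:
  fixes \<Phi> :: "'b::real_normed_vector \<Rightarrow> real^'n^'n"
  assumes \<Phi>: "param_family R \<Phi> D"
    and R: "\<And>s X. s \<ge> 0 \<Longrightarrow> X \<in> R \<Longrightarrow> matrix_exp s M ** X \<in> R"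
    and \<phi>: "bounded_linear \<phi>" and t: "t > 0"
  shows "param_family R (\<lambda>Z. matrix_exp (t + \<phi> Z) M ** \<Phi> Z)
    (\<lambda>Z. matrix_exp t M ** (\<phi> Z *\<^sub>R (M ** \<Phi> 0) + D Z))"
proof -
  from \<Phi> obtain S where D: "(\<Phi> has_derivative D) (at 0)"
    and S: "open S" "0 \<in> S" "continuous_on S \<Phi>" "\<Phi> ` S \<subseteq> R"
    unfolding param_family_def by blast
  have \<phi>0: "\<phi> 0 = 0" using \<phi> linear_simps(3) by blast
  have cont: "continuous_on A (\<lambda>Z. t + \<phi> Z)" for A
    by (intro continuous_intros bounded_linear.continuous_on[OF \<phi>])
  have "((\<lambda>Z. t + \<phi> Z) has_derivative \<phi>) (at 0)"
    by (auto intro!: derivative_eq_intros bounded_linear_imp_has_derivative \<phi>)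
  moreover have "((\<lambda>s. matrix_exp s M) has_derivative (\<lambda>s. s *\<^sub>R (M ** matrix_exp t M))) (at (t + \<phi> 0))"
    using matrix_exp_has_vector_derivative[of M t] by (simp add: has_vector_derivative_def \<phi>0)
  ultimately have "((\<lambda>s. matrix_exp s M) \<circ> (\<lambda>Z. t + \<phi> Z) has_derivative
      (\<lambda>s. s *\<^sub>R (M ** matrix_exp t M)) \<circ> \<phi>) (at 0)"
    by (rule diff_chain_at)
  then have "((\<lambda>Z. matrix_exp (t + \<phi> Z) M) has_derivative
      (\<lambda>Z. \<phi> Z *\<^sub>R (M ** matrix_exp t M))) (at 0)"
    by (simp add: o_def)
  from matrix_mult.FDERIV[OF this D]
  have "((\<lambda>Z. matrix_exp (t + \<phi> Z) M ** \<Phi> Z) has_derivative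
      (\<lambda>Z. matrix_exp t M ** (\<phi> Z *\<^sub>R (M ** \<Phi> 0) + D Z))) (at 0)"
    by (simp add: \<phi>0 matrix_mult.add_right matrix_mult.scaleR_left matrix_mult.scaleR_right
        matrix_mul_assoc matrix_exp_commute add.commute)
  moreover have "open (S \<inter> {Z. 0 < t + \<phi> Z})"
    using S(1) cont by (intro open_Int open_Collect_less) auto
  moreover have "continuous_on (S \<inter> {Z. 0 < t + \<phi> Z}) (\<lambda>Z. matrix_exp (t + \<phi> Z) M ** \<Phi> Z)"
    by (intro matrix_mult.continuous_on continuous_on_subset[OF S(3)]
        continuous_on_compose2[of UNIV "\<lambda>s. matrix_exp s M", OF _ cont]
        continuous_at_imp_continuous_on ballI isCont_matrix_exp) auto
  ultimately show ?thesis
    unfolding param_family_def using S t R \<phi>0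
    by (intro conjI exI[of _ "S \<inter> {Z. 0 < t + \<phi> Z}"]) (auto intro!: R)
qed

lemma param_family_mult:
  fixes \<Phi> :: "'b::real_normed_vector \<Rightarrow> real^'n^'n"
  assumes \<Phi>: "param_family R \<Phi> D" and R: "\<And>X. X \<in> R \<Longrightarrow> h ** X \<in> R"
  shows "param_family R (\<lambda>Z. h ** \<Phi> Z) (\<lambda>Z. h ** D Z)"
proof -
  from \<Phi> obtain S where D: "(\<Phi> has_derivative D) (at 0)"
    and S: "open S" "0 \<in> S" "continuous_on S \<Phi>" "\<Phi> ` S \<subseteq> R"
    unfolding param_family_def by blast
  have "((\<lambda>Z. h ** \<Phi> Z) has_derivative (\<lambda>Z. h ** D Z)) (at 0)"
    by (rule bounded_linear.has_derivative[OF matrix_mult.bounded_linear_right D])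
  moreover have "continuous_on S (\<lambda>Z. h ** \<Phi> Z)"
    by (rule bounded_linear.continuous_on[OF matrix_mult.bounded_linear_right S(3)])
  ultimately show ?thesis
    unfolding param_family_def using S R by (intro conjI exI[of _ S]) auto
qed

text \<open>The functional is 1 at the kernel vector \<open>z\<close>, so \<open>z\<close> is sent
  to \<open>w\<close>; hence the new range contains \<open>w\<close> and, after subtracting
  multiples of it, the old range.\<close>

lemma dim_range_rank_one_update:
  fixes D :: "'a::euclidean_space \<Rightarrow> 'b::euclidean_space"
  assumes D: "linear D" and z: "z \<noteq> 0" "D z = 0" and w: "w \<notin> range D"
  shows "dim (range D) < dim (range (\<lambda>Z. (Z \<bullet> z / (z \<bullet> z)) *\<^sub>R w + D Z))"
proof -
  let ?F = "\<lambda>Z. (Z \<bullet> z / (z \<bullet> z)) *\<^sub>R w + D Z"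
  have F: "linear ?F"
    using D by (intro linearI)
      (simp_all add: linear_add linear_scale inner_add_left algebra_simps add_divide_distrib)
  have sub: "subspace (range D)" "subspace (range ?F)"
    using linear_subspace_image[OF D subspace_UNIV] linear_subspace_image[OF F subspace_UNIV]
    by auto
  have w': "w \<in> range ?F" using z by (intro range_eqI[of _ _ z]) simp
  have "D Z \<in> range ?F" for Z
  proof -
    have "?F Z - (Z \<bullet> z / (z \<bullet> z)) *\<^sub>R w \<in> range ?F"
      using sub(2) w' by (intro subspace_diff subspace_scale) auto
    then show ?thesis by simp
  qed
  then have "range D \<subset> range ?F" using w w' by blast
  then show ?thesis
    using sub by (intro dim_psubset) (simp add: span_eq_iff[THEN iffD2])
qed

text \<open>Flows are available only forward in time, so a derivative has to be obtained as a limit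
  from the right.\<close>

lemma has_vector_derivative_imp_right_quotient:
  assumes "(f has_vector_derivative d) (at 0)"
  shows "((\<lambda>t. (1 / t) *\<^sub>R (f t - f 0)) \<longlongrightarrow> d) (at_right 0)"
proof -
  have "((\<lambda>t. (1 / norm (t - 0)) *\<^sub>R (f t - (f 0 + (t - 0) *\<^sub>R d))) \<longlongrightarrow> 0) (at_right 0)"
    using has_vector_derivative_at_within[OF assms, of "{0<..}"]
    unfolding has_vector_derivative_def has_derivative_within by blast
  moreover have "\<forall>\<^sub>F t in at_right 0. (1 / norm (t - 0)) *\<^sub>R (f t - (f 0 + (t - 0) *\<^sub>R d)) =
      (1 / t) *\<^sub>R (f t - f 0) - d"
    by (auto simp: eventually_at_filter algebra_simps)
  ultimately have "((\<lambda>t. (1 / t) *\<^sub>R (f t - f 0) - d) \<longlongrightarrow> 0) (at_right 0)"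
    by (rule Lim_transform_eventually)
  then show ?thesis by (rule LIM_zero_cancel)
qed

text \<open>The hypothesis \<open>lie\<close> expresses that \<open>\<M>\<close> generates all
  matrices as a Lie algebra. It is phrased by subspaces invariant under brackets with
  \<open>\<M>\<close>, the form of invariance that flows produce.\<close>

lemma interior_nonempty_if_lie_rank:
  fixes R :: "(real^'n^'n) set" and \<M> :: "(real^'n^'n) set"
  assumes one: "mat 1 \<in> R"
    and R: "\<And>M t X. M \<in> \<M> \<Longrightarrow> t \<ge> 0 \<Longrightarrow> X \<in> R \<Longrightarrow> matrix_exp t M ** X \<in> R"
    and inv: "\<And>X. X \<in> R \<Longrightarrow> invertible X"
    and lie: "\<And>U. subspace U \<Longrightarrow> \<M> \<subseteq> U \<Longrightarrow> (\<And>M Z. M \<in> \<M> \<Longrightarrow> Z \<in> U \<Longrightarrow> commutator M Z \<in> U)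
      \<Longrightarrow> U = UNIV"
  shows "interior R \<noteq> {}"
proof -
  let ?rk = "\<lambda>D :: real^'n^'n \<Rightarrow> real^'n^'n. dim (range D)"
  let ?Q = "\<lambda>r. \<exists>\<Phi> D. param_family R \<Phi> D \<and> ?rk D = r"
  \<comment> \<open>The constant family shows that some rank occurs; ranks are bounded, so a maximal
    one exists.\<close>
  have "param_family R (\<lambda>_ :: real^'n^'n. mat 1) (\<lambda>_. 0)"
    unfolding param_family_def using one by (auto intro!: exI[of _ UNIV])
  then have "\<exists>r. ?Q r" by blast
  moreover have "\<And>r. ?Q r \<Longrightarrow> r \<le> DIM(real^'n^'n)" using dim_subset_UNIV by blast
  ultimately obtain r where "?Q r" and max: "\<And>r'. ?Q r' \<Longrightarrow> r' \<le> r"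
    using Nat.ex_has_greatest_nat[of ?Q] by blast
  then obtain \<Phi> D where \<Phi>: "param_family R \<Phi> D" and r: "?rk D = r" by blast
  have D: "linear D"
    using \<Phi> has_derivative_linear unfolding param_family_def by blast
  have "invertible (\<Phi> 0)" using \<Phi> inv unfolding param_family_def by blast
  then obtain g' where g': "g' ** \<Phi> 0 = mat 1" unfolding invertible_def by blast
  have "surj D"
  proof (rule ccontr)
    assume "\<not> surj D"
    then have "\<not> inj D" using D linear_injective_imp_surjective by blast
    then obtain z where z: "z \<noteq> 0" "D z = 0"
      using linear_injective_0[OF D] by blast
    define \<phi> where "\<phi> Z = Z \<bullet> z / (z \<bullet> z)" for Z
    have \<phi>: "bounded_linear \<phi>"
      unfolding \<phi>_def
      by (rule bounded_linear_compose[OF bounded_linear_divide bounded_linear_inner_left])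
    \<comment> \<open>These are the invertible left multiplications that preserve \<open>R\<close>,
      each paired with its inverse. \<open>W\<close> is the tangent space moved to the identity by
      right translation, and \<open>U\<close> collects the \<open>Z\<close> all of whose conjugates
      by such \<open>h\<close> lie in \<open>W\<close>.\<close>
    let ?mono = "{(h, h'). h ** h' = mat 1 \<and> h' ** h = mat 1 \<and> (\<forall>X\<in>R. h ** X \<in> R)}"
    define W where "W = {w. w ** \<Phi> 0 \<in> range D}"
    define U where "U = {Z. \<forall>(h, h')\<in>?mono. h' ** Z ** h \<in> W}"
    \<comment> \<open>Otherwise \<open>M\<close> would be transversal to the family moved by
      \<open>h\<close>, and flowing along \<open>M\<close> would beat the maximal rank.\<close>
    have tangent: "h' ** M ** h \<in> W" if h: "(h, h') \<in> ?mono" and M: "M \<in> \<M>" for h h' M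
    proof (rule ccontr)
      assume nW: "h' ** M ** h \<notin> W"
      have hh: "h ** h' = mat 1" "h' ** h = mat 1"
        using h by auto
      then have hinv: "invertible h" unfolding invertible_def by blast
      have fam: "param_family R (\<lambda>Z. h ** \<Phi> Z) (\<lambda>Z. h ** D Z)"
        using param_family_mult[OF \<Phi>] h by blast
      have w: "M ** (h ** \<Phi> 0) \<notin> range (\<lambda>Z. h ** D Z)"
      proof
        assume "M ** (h ** \<Phi> 0) \<in> range (\<lambda>Z. h ** D Z)"
        then obtain Z where "M ** (h ** \<Phi> 0) = h ** D Z" by blast
        then have "h' ** (M ** (h ** \<Phi> 0)) = D Z"
          by (simp add: matrix_mul_assoc hh)
        then show False using nW by (simp add: W_def matrix_mul_assoc)
      qed
      let ?D = "\<lambda>Z. \<phi> Z *\<^sub>R (M ** (h ** \<Phi> 0)) + h ** D Z"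
      have "inj ((**) k)" if "invertible k" for k :: "real^'n^'n"
        using that unfolding invertible_def by (metis injI matrix_mul_assoc matrix_mul_lid)
      then have dim_mult: "dim ((**) k ` S) = dim S" if "invertible k" for k :: "real^'n^'n" and S
        using that by (intro dim_image_eq)
          (auto intro: inj_on_subset bounded_linear.linear matrix_mult.bounded_linear_right)
      have linhD: "linear (\<lambda>Z. h ** D Z)"
        using linear_compose[OF D bounded_linear.linear[OF matrix_mult.bounded_linear_right[of h]]]
        by (simp add: o_def)
      have "r = dim (range (\<lambda>Z. h ** D Z))"
        using dim_mult[OF hinv, of "range D"] r by (simp add: image_image)
      also have "\<dots> < dim (range ?D)"
        unfolding \<phi>_def
        by (rule dim_range_rank_one_update) (use linhD z w in auto)
      also have "\<dots> = dim (range (\<lambda>Z. matrix_exp 1 M ** ?D Z))"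
      proof -
        have "invertible (matrix_exp 1 M)"
          by (metis invertible_def matrix_exp_mult_uminus matrix_exp_uminus_mult)
        then show ?thesis using dim_mult[of "matrix_exp 1 M" "range ?D"] by (simp add: image_image)
      qed
      \<comment> \<open>The base time 1 is an arbitrary positive choice.\<close>
      also have "\<dots> \<le> r"
        using param_family_matrix_exp[OF fam R[OF M] \<phi>, of 1] by (intro max) auto
      finally show False by simp
    qed
    have linW: "linear (\<lambda>w. w ** \<Phi> 0)"
      by (rule bounded_linear.linear[OF matrix_mult.bounded_linear_left])
    have subW: "subspace W"
      unfolding W_def
      using linear_subspace_vimage[OF linW linear_subspace_image[OF D subspace_UNIV]]
      by (simp add: vimage_def)
    have subU: "subspace U"
      using subW unfolding subspace_def U_def
      by (auto simp: matrix_mult.add_left matrix_mult.add_right matrix_mult.scaleR_left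
          matrix_mult.scaleR_right)
    \<comment> \<open>Composing \<open>h\<close> with the flow of \<open>M\<close> gives another
      element of \<open>?mono\<close>.\<close>
    have conj: "matrix_exp (- t) M ** Z ** matrix_exp t M \<in> U"
      if M: "M \<in> \<M>" and Z: "Z \<in> U" and t: "t \<ge> 0" for M Z t
    proof -
      have "h' ** (matrix_exp (- t) M ** Z ** matrix_exp t M) ** h \<in> W"
        if h: "(h, h') \<in> ?mono" for h h'
      proof -
        let ?k = "matrix_exp t M ** h" and ?k' = "h' ** matrix_exp (- t) M"
        have hh: "h ** h' = mat 1" "h' ** h = mat 1" using h by auto
        have "?k ** ?k' = matrix_exp t M ** (h ** h') ** matrix_exp (- t) M"
          "?k' ** ?k = h' ** (matrix_exp (- t) M ** matrix_exp t M) ** h"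
          by (simp_all only: matrix_mul_assoc)
        then have "?k ** ?k' = mat 1" "?k' ** ?k = mat 1"
          by (simp_all add: hh matrix_exp_mult_uminus matrix_exp_uminus_mult)
        then have "(?k, ?k') \<in> ?mono"
          using h R[OF M t] by (simp add: matrix_mul_assoc[symmetric])
        then have "?k' ** Z ** ?k \<in> W" using Z unfolding U_def by blast
        then show ?thesis by (simp add: matrix_mul_assoc)
      qed
      then show ?thesis unfolding U_def by blast
    qed
    have "commutator M Z \<in> U" if M: "M \<in> \<M>" and Z: "Z \<in> U" for M Z
    proof -
      \<comment> \<open>This curve stays in the closed subspace \<open>U\<close> for
        \<open>t \<ge> 0\<close>, and its derivative at 0 is the negative of the commutator.\<close>
      let ?f = "\<lambda>t. matrix_exp (- t) M ** Z ** matrix_exp t M"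
      have "(?f has_vector_derivative Z ** M - M ** Z) (at 0)"
        using matrix_mult.has_vector_derivative[OF
            bounded_linear.has_vector_derivative[OF matrix_mult.bounded_linear_left
              matrix_exp_uminus_has_vector_derivative[of M 0], of Z]
            matrix_exp_has_vector_derivative[of M 0]]
        by (simp add: matrix_mult.minus_left)
      then have lim: "((\<lambda>t. (1 / t) *\<^sub>R (?f t - ?f 0)) \<longlongrightarrow> Z ** M - M ** Z) (at_right 0)"
        by (rule has_vector_derivative_imp_right_quotient)
      have "Z ** M - M ** Z \<in> U"
      proof (rule Lim_in_closed_set[OF closed_subspace[OF subU] _ _ lim])
        show "\<forall>\<^sub>F t in at_right 0. (1 / t) *\<^sub>R (?f t - ?f 0) \<in> U"
          unfolding eventually_at_filter
          using conj[OF M Z] conj[OF M Z, of 0]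
          by (intro always_eventually allI impI subspace_scale subspace_diff subU) auto
      qed simp
      from subspace_neg[OF subU this] show ?thesis by (simp add: commutator_def)
    qed
    moreover have "\<M> \<subseteq> U" using tangent by (auto simp: U_def)
    ultimately have "U = UNIV" using lie[OF subU] by blast
    have "W = UNIV"
    proof -
      have "Z \<in> W" for Z
      proof -
        have "Z \<in> U" using \<open>U = UNIV\<close> by simp
        moreover have "(mat 1, mat 1) \<in> ?mono" by auto
        ultimately have "mat 1 ** Z ** mat 1 \<in> W" unfolding U_def by blast
        then show ?thesis by simp
      qed
      then show ?thesis by blast
    qed
    have "Y \<in> range D" for Y
    proof -
      \<comment> \<open>Undoing the right translation by \<open>\<Phi> 0\<close> shows that
        \<open>D\<close> is onto.\<close>
      have "(Y ** g') ** \<Phi> 0 = Y"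
        using g' by (simp add: matrix_mul_assoc[symmetric])
      moreover have "Y ** g' \<in> W" using \<open>W = UNIV\<close> by simp
      ultimately show ?thesis by (simp add: W_def)
    qed
    then show False using \<open>\<not> surj D\<close> by blast
  qed
  then show ?thesis using interior_nonempty_if_param_family_surj \<Phi> by blast
qed

section \<open>Reachable sets\<close>

text \<open>The switching time \<open>T\<close> becomes a possible discontinuity and so needs a left
  limit there; if \<open>u\<close> had no exception at \<open>T\<close>, continuity within
  \<open>{a..T}\<close> provides it.\<close>

lemma piecewise_continuous_on_extend_const:
  assumes u: "piecewise_continuous_on a T u" and "a \<le> T" "T < b"
  shows "piecewise_continuous_on a b (\<lambda>t. if t \<le> T then u t else c)"
proof -
  let ?f = "\<lambda>t. if t \<le> T then u t else c"
  from u obtain S where S: "finite S" "S \<subseteq> {a..T}" "continuous_on ({a..T} - S) u"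
    and lim: "\<And>s. s \<in> S \<Longrightarrow> a < s \<Longrightarrow> \<exists>l. (u \<longlongrightarrow> l) (at_left s)"
      "\<And>s. s \<in> S \<Longrightarrow> s < T \<Longrightarrow> \<exists>l. (u \<longlongrightarrow> l) (at_right s)"
    unfolding piecewise_continuous_on_def by blast
  have left: "\<exists>l. (u \<longlongrightarrow> l) (at_left T)" if "a < T"
  proof (cases "T \<in> S")
    case False
    have "at_left T = at T within ({a..T} - S)"
      using S(1) False that
      by (intro at_within_nhd[of _ "{a<..} - S"]) (auto simp: finite_imp_closed intro!: open_Diff)
    then show ?thesis
      using S(3) False that unfolding continuous_on_def by (metis DiffI atLeastAtMost_iff order.refl less_imp_le)
  qed (use lim that in auto)
  have "continuous_on (({a..<T} - S) \<union> {T<..b}) ?f"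
  proof (rule continuous_on_Un_local_open)
    show "openin (top_of_set (({a..<T} - S) \<union> {T<..b})) ({a..<T} - S)"
      by (auto simp: openin_open intro!: exI[of _ "{..<T}"])
    show "openin (top_of_set (({a..<T} - S) \<union> {T<..b})) {T<..b}"
      by (auto simp: openin_open intro!: exI[of _ "{T<..}"])
    show "continuous_on ({a..<T} - S) ?f"
      by (rule continuous_on_eq[OF continuous_on_subset[OF S(3)]]) auto
    show "continuous_on {T<..b} ?f"
      by (rule continuous_on_eq[OF continuous_on_const[of _ c]]) auto
  qed
  moreover have "({a..<T} - S) \<union> {T<..b} = {a..b} - insert T S"
    using S(2) assms(2,3) by auto
  moreover have "\<exists>l. (?f \<longlongrightarrow> l) (at_left s)" if s: "s \<in> insert T S" "a < s" for s
  proof -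
    have "s \<le> T" using s S(2) by auto
    obtain l where "(u \<longlongrightarrow> l) (at_left s)" using s left lim(1) by blast
    moreover have "\<forall>\<^sub>F t in at_left s. u t = ?f t"
      using \<open>s \<le> T\<close> by (auto simp: eventually_at_filter)
    ultimately have "(?f \<longlongrightarrow> l) (at_left s)" by (rule Lim_transform_eventually)
    then show ?thesis ..
  qed
  moreover have "\<exists>l. (?f \<longlongrightarrow> l) (at_right s)" if s: "s \<in> insert T S" for s
  proof (cases "s = T")
    case True
    have "\<forall>\<^sub>F t in at_right s. ?f t = c"
      using True by (auto simp: eventually_at_filter)
    then have "(?f \<longlongrightarrow> c) (at_right s)" by (rule tendsto_eventually)
    then show ?thesis ..
  next
    case False
    then have sT: "s \<in> S" "s < T" using s S(2) by force+
    then obtain l where "(u \<longlongrightarrow> l) (at_right s)" using lim(2) by blast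
    moreover have "\<forall>\<^sub>F t in at_right s. u t = ?f t"
      using eventually_at_right[OF sT(2)] sT by (auto intro!: exI[of _ T])
    ultimately have "(?f \<longlongrightarrow> l) (at_right s)" by (rule Lim_transform_eventually)
    then show ?thesis ..
  qed
  ultimately show ?thesis
    unfolding piecewise_continuous_on_def
    using S(1,2) assms(2,3) by (intro exI[of _ "insert T S"]) auto
qed

lemma mat_1_in_reachable_set: "mat 1 \<in> reachable_set B0 m B"
  unfolding reachable_set_def mem_Collect_eq
  \<comment> \<open>At time horizon 0 the exceptional set \<open>{0}\<close> removes the only
    instant at which the equation would be required.\<close>
  by (rule exI[of _ 0], rule exI[of _ "\<lambda>_ _. 0"], rule exI[of _ "\<lambda>_. mat 1"], rule exI[of _ "{0}"])
    (auto simp: piecewise_continuous_on_def GLplus_def intro!: exI[of _ "{}"])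

text \<open>Concatenation: after the given control, the constant control \<open>c\<close> runs for
  time \<open>s\<close>. The junction \<open>T\<close> joins the exceptional set since the velocity
  may jump there.\<close>

lemma matrix_exp_mult_in_reachable_set:
  fixes B0 :: "real^'n^'n"
  assumes Y: "Y \<in> reachable_set B0 m B" and s: "s \<ge> 0"
  shows "matrix_exp s (B0 + (\<Sum>k=1..m. c k *\<^sub>R B k)) ** Y \<in> reachable_set B0 m B"
proof (cases "s = 0")
  case False
  then have s: "s > 0" using s by simp
  let ?M = "B0 + (\<Sum>k=1..m. c k *\<^sub>R B k)"
  from Y obtain T u X S where T: "T \<ge> 0"
    and u: "\<And>k. k \<in> {1..m} \<Longrightarrow> piecewise_continuous_on 0 T (u k)"
    and S: "finite S" and X: "continuous_on {0..T} X" "X 0 = mat 1" "X T = Y"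
    and pos: "\<And>t. t \<in> {0..T} \<Longrightarrow> X t \<in> GLplus"
    and deriv: "\<And>t. t \<in> {0..T} - S \<Longrightarrow> (X has_vector_derivative
        (B0 + (\<Sum>k=1..m. u k t *\<^sub>R B k)) ** X t) (at t within {0..T})"
    unfolding reachable_set_def by blast
  define v where "v k t = (if t \<le> T then u k t else c k)" for k t
  define Z where "Z t = (if t \<le> T then X t else matrix_exp (t - T) ?M ** Y)" for t
  have Z_deriv: "((\<lambda>t. matrix_exp (t - T) ?M ** Y) has_vector_derivative
      ?M ** (matrix_exp (t - T) ?M ** Y)) (at t)" for t
  proof -
    have "((\<lambda>t. matrix_exp t ?M) \<circ> (\<lambda>t. t - T) has_vector_derivative
        1 *\<^sub>R (?M ** matrix_exp (t - T) ?M)) (at t)"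
      by (rule vector_diff_chain_at)
        (auto intro!: derivative_eq_intros matrix_exp_has_vector_derivative)
    from bounded_linear.has_vector_derivative[OF matrix_mult.bounded_linear_left this, of Y]
    show ?thesis by (simp add: o_def matrix_mul_assoc)
  qed
  have "continuous_on {0..T + s} Z"
    unfolding Z_def
  proof (rule continuous_on_cases_le[where h = "\<lambda>t. t"])
    show "continuous_on {t \<in> {0..T + s}. t \<le> T} X"
      by (rule continuous_on_subset[OF X(1)]) auto
    show "continuous_on {t \<in> {0..T + s}. T \<le> t} (\<lambda>t. matrix_exp (t - T) ?M ** Y)"
      using Z_deriv has_vector_derivative_continuous
      by (intro continuous_at_imp_continuous_on ballI) blast
  qed (use X in \<open>auto intro: continuous_intros\<close>)
  moreover have "Z t \<in> GLplus" if "t \<in> {0..T + s}" for t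
    using pos[of t] pos[of T] that X T by (auto simp: Z_def GLplus_def det_mul det_matrix_exp_pos)
  moreover have "(Z has_vector_derivative (B0 + (\<Sum>k=1..m. v k t *\<^sub>R B k)) ** Z t)
      (at t within {0..T + s})" if t: "t \<in> {0..T + s} - insert T S" for t
  proof (cases "t < T")
    case True
    have "at t within {0..T + s} = at t within {0..T}"
      using True s by (intro at_within_nhd[of _ "{..<T}"]) auto
    then have "(X has_vector_derivative (B0 + (\<Sum>k=1..m. v k t *\<^sub>R B k)) ** Z t)
        (at t within {0..T + s})"
      using deriv[of t] True t by (simp add: v_def Z_def)
    then show ?thesis
      by (rule has_vector_derivative_transform_within[of _ _ _ _ "T - t"])
        (use True t in \<open>auto simp: Z_def dist_real_def\<close>)
  next
    case False
    then have "T < t" using t by auto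
    then have "((\<lambda>t. matrix_exp (t - T) ?M ** Y) has_vector_derivative
        (B0 + (\<Sum>k=1..m. v k t *\<^sub>R B k)) ** Z t) (at t within {0..T + s})"
      using has_vector_derivative_at_within[OF Z_deriv] by (simp add: v_def Z_def)
    then show ?thesis
      by (rule has_vector_derivative_transform_within[of _ _ _ _ "t - T"])
        (use \<open>T < t\<close> t in \<open>auto simp: Z_def dist_real_def\<close>)
  qed
  moreover have "piecewise_continuous_on 0 (T + s) (v k)" if "k \<in> {1..m}" for k
    unfolding v_def using u[OF that] T s by (intro piecewise_continuous_on_extend_const) auto
  moreover have "Z 0 = mat 1" "Z (T + s) = matrix_exp s ?M ** Y"
    using T X s by (auto simp: Z_def)
  ultimately show ?thesis
    unfolding reachable_set_def mem_Collect_eq using T s S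
    by (intro exI[of _ "T + s"] exI[of _ v] exI[of _ Z] exI[of _ "insert T S"]) auto
qed (use Y in simp)

lemma reachable_set_subset_GLplus: "reachable_set B0 m B \<subseteq> GLplus"
  by (auto simp: reachable_set_def)

section \<open>Combining the rank condition with the digraph hypotheses\<close>

lemma generator_in_sigma_f:
  assumes "finite G" "g \<in> G"
  shows "g \<in> sigma_f G"
proof -
  have "(if h = g then 1 else 0) *\<^sub>R h = (if h = g then h else 0)" for h by simp
  then have "g = (\<Sum>h\<in>G. (if h = g then 1 else 0) *\<^sub>R h)"
    using assms by simp
  then show ?thesis unfolding sigma_f_def by (intro CollectI exI conjI TrueI)
qed

theorem theorem2:
  fixes A :: "nat \<Rightarrow> real ^ 'n ^ 'n" and d :: nat
    and P :: "('n::finite \<times> 'n) set"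
  assumes "d \<ge> 1"
    and weak_strong: "\<forall>i. strongly_connected_on P (weak_component P i) \<and>
                           card (weak_component P i) \<ge> 2"
    and union_strong: "strongly_connected_on (drift_graph d A \<union> P) UNIV"
    and self_loop: "\<exists>i. (i, i) \<in> P"
  shows "structurally_accessible {A s | s. s \<in> {1..d}} {Emat i j | i j. (i, j) \<in> P}"
proof -
  let ?Ga = "{A s | s. s \<in> {1..d}}" and ?Gb = "{Emat i j | i j. (i, j) \<in> P}"
  have fin: "finite ?Ga" "finite ?Gb"
  proof -
    have "?Gb = (\<lambda>(i, j). Emat i j) ` P" by auto
    then show "finite ?Gb" by simp
  qed simp
  \<comment> \<open>A generic drift keeps every arc of the drift graph.\<close>
  obtain l where l: "\<forall>g\<in>?Ga. l g \<noteq> 0"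
    "\<And>i j. \<exists>g\<in>?Ga. g $ i $ j \<noteq> 0 \<Longrightarrow> (\<Sum>g\<in>?Ga. l g *\<^sub>R g) $ i $ j \<noteq> 0"
    using generic_combination[OF fin(1)] by blast
  define B0 where "B0 = (\<Sum>g\<in>?Ga. l g *\<^sub>R g)"
  have B0: "B0 \<in> sigma_r ?Ga" unfolding B0_def sigma_r_def using l(1) by blast
  have drift: "drift_graph d A \<subseteq> {(a, b). B0 $ a $ b \<noteq> 0}"
    using l(2) unfolding drift_graph_def B0_def by blast
  obtain k where k: "(k, k) \<in> P" using self_loop by blast
  \<comment> \<open>A node reachable from \<open>a\<close> lies in the weak component of
    \<open>a\<close>, where strong connectivity provides the way back.\<close>
  have sym: "(b, a) \<in> P\<^sup>*" if "(a, b) \<in> P\<^sup>*" for a b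
  proof -
    have "b \<in> weak_component P a"
      using that rtrancl_mono[of P "P \<union> P\<inverse>"] unfolding weak_component_def by blast
    moreover have "a \<in> weak_component P a" by (simp add: weak_component_def)
    ultimately show ?thesis using weak_strong unfolding strongly_connected_on_def by blast
  qed
  have two: "\<exists>b. b \<noteq> a \<and> (a, b) \<in> P\<^sup>*" for a
  proof -
    have "\<not> weak_component P a \<subseteq> {a}"
    proof
      assume "weak_component P a \<subseteq> {a}"
      then have "card (weak_component P a) \<le> 1" using card_mono[of "{a}"] by fastforce
      then show False using weak_strong by (metis Suc_1 not_less_eq_eq One_nat_def)
    qed
    then obtain b where "b \<in> weak_component P a" "b \<noteq> a" by blast
    moreover have "a \<in> weak_component P a" by (simp add: weak_component_def)
    ultimately show ?thesis using weak_strong unfolding strongly_connected_on_def by blast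
  qed
  have conn: "(a, b) \<in> ({(a, b). B0 $ a $ b \<noteq> 0} \<union> P)\<^sup>*" for a b
    using union_strong rtrancl_mono[OF Un_mono[OF drift order.refl[of P]]]
    unfolding strongly_connected_on_def by blast
  \<comment> \<open>One control is used per arc of \<open>P\<close>, numbered from 1 as the control
    index range requires.\<close>
  obtain e where e: "bij_betw e {1..card P} P"
    using ex_bij_betw_nat_finite_1[of P] by auto
  define m where "m = card P"
  define B where "B q = Emat (fst (e q)) (snd (e q))" for q
  have "m \<ge> 1" using k unfolding m_def by (metis One_nat_def Suc_leI card_gt_0_iff empty_iff finite)
  moreover have "B q \<in> sigma_f ?Gb" if "q \<in> {1..m}" for q
  proof -
    have "e q \<in> P" using e that unfolding m_def by (rule bij_betw_apply)
    then show ?thesis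
      unfolding B_def by (intro generator_in_sigma_f fin(2) CollectI exI[of _ "fst (e q)"] exI[of _ "snd (e q)"])
        simp
  qed
  moreover have "interior (reachable_set B0 m B) \<noteq> {}"
  proof (rule interior_nonempty_if_lie_rank)
    let ?M = "range (\<lambda>c. B0 + (\<Sum>q=1..m. c q *\<^sub>R B q))"
    show "mat 1 \<in> reachable_set B0 m B" by (rule mat_1_in_reachable_set)
    show "matrix_exp t M ** X \<in> reachable_set B0 m B"
      if "M \<in> ?M" "t \<ge> 0" "X \<in> reachable_set B0 m B" for M t X
      using that matrix_exp_mult_in_reachable_set by blast
    show "invertible X" if "X \<in> reachable_set B0 m B" for X
      using that reachable_set_subset_GLplus[of B0 m B] by (auto simp: GLplus_def invertible_det_nz)
    fix U assume U: "subspace U" "?M \<subseteq> U" "\<And>M Z. M \<in> ?M \<Longrightarrow> Z \<in> U \<Longrightarrow> commutator M Z \<in> U"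
    define N where "N = {X \<in> U. \<forall>Z\<in>U. commutator X Z \<in> U}"
    interpret matrix_lie_algebra N
      unfolding N_def by (rule matrix_lie_algebra_stabilizer[OF U(1)])
    have MN: "B0 + (\<Sum>q=1..m. c q *\<^sub>R B q) \<in> N" for c
      using U(2,3) unfolding N_def by blast
    have B0N: "B0 \<in> N" using MN[of "\<lambda>_. 0"] by simp
    \<comment> \<open>The affine space \<open>?M\<close> gives the control matrices as differences:
      switch on one control with value 1 and subtract the drift.\<close>
    have "Emat a b \<in> N" if "(a, b) \<in> P" for a b
    proof -
      have "(a, b) \<in> e ` {1..m}" using e that by (simp add: bij_betw_def m_def)
      then obtain q where q: "q \<in> {1..m}" "e q = (a, b)" by (elim imageE) simp
      have "(if p = q then 1 else 0) *\<^sub>R B p = (if p = q then B p else 0)" for p by simp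
      then have "(\<Sum>p=1..m. (if p = q then 1 else 0) *\<^sub>R B p) = B q"
        using q(1) by simp
      then have "B0 + B q - B0 \<in> N"
        using subspace_diff[OF subspace MN[of "\<lambda>p. if p = q then 1 else 0"] B0N] by simp
      then show ?thesis using q(2) by (simp add: B_def)
    qed
    then have "N = UNIV" by (rule eq_UNIV) (use B0N sym two k conn in auto)
    then show "U = UNIV" unfolding N_def by blast
  qed
  then have "accessible B0 m B"
    using reachable_set_subset_GLplus[of B0 m B] unfolding accessible_def by (simp add: Int_absorb2)
  ultimately show ?thesis
    unfolding structurally_accessible_def using B0 by blast
qed

end
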